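(* Let $a$ and $b$ be positive integers with $a\ge 3$, and consider the Pell equation $x^{2}-(a^{2}b^{2}-2b)y^{2}=1$. Then the following hold. (i) The continued fraction expansion of $\sqrt{a^{2}b^{2}-2b}$ is $$\sqrt{a^{2}b^{2}-2b}=[ab-1;\overline{1,a-2,1,2ab-2}].$$ (ii) The fundamental solution of the equation is $(x_{1},y_{1})=(a^{2}b-1,a)$. (iii) The $n$-th solution $(x_{n},y_{n})$ of the equation can be found by $$\frac{x_{n}}{y_{n}}=[ab-1;(1,a-2,1,2ab-2)_{n-1},1].$$
   Context: $[a_0;a_1,a_2,\dots]$ denotes the simple continued fraction $a_0+\cfrac{1}{a_1+\cfrac{1}{a_2+\cdots}}$ (finite or infinite), and an overline marks the block of partial quotients that repeats periodically. The notation $(1,a-2,1,2ab-2)_{n-1}$ inside a continued fraction means that there are $n-1$ successive blocks $1,a-2,1,2ab-2$. For a positive non-square integer $d$, the fundamental solution $(x_1,y_1)$ of $x^2-dy^2=1$ is its smallest solution in positive integers, and the $n$-th solution $(x_n,y_n)$, $n\ge 1$, is given by $x_n+y_n\sqrt d=(x_1+y_1\sqrt d)^n$.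
   Formalization: In (iii) the continued fraction is corrected to end in 1, a-2, 1 after the n-1 blocks, instead of just 1; as printed it is false: for n=1 it gives [ab-1;1]=ab, but x_1/y_1=ab-1/a by (ii). *)

theory Defs
  imports Complex_Main
begin

fun cfrac_value :: "int \<Rightarrow> int list \<Rightarrow> real" where
  "cfrac_value a0 [] = of_int a0"
| "cfrac_value a0 (a1 # as) = of_int a0 + 1 / cfrac_value a1 as"

text \<open>An infinite simple continued fraction: all partial quotients after the first are
  positive integers, and the value is the limit of the convergents.\<close>

definition has_cfrac_expansion :: "real \<Rightarrow> (nat \<Rightarrow> int) \<Rightarrow> bool" where
  "has_cfrac_expansion x a \<longleftrightarrow>
     (\<forall>i\<ge>1. a i \<ge> 1) \<and> (\<lambda>n. cfrac_value (a 0) (map a [1..<Suc n])) \<longlonglongrightarrow> x"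

definition periodic_quotients :: "int \<Rightarrow> int list \<Rightarrow> nat \<Rightarrow> int" where
  "periodic_quotients a0 block i = (if i = 0 then a0 else block ! ((i - 1) mod length block))"

definition is_pell_solution :: "int \<Rightarrow> int \<times> int \<Rightarrow> bool" where
  "is_pell_solution d = (\<lambda>(x, y). x^2 - d * y^2 = 1)"

text \<open>For positive solutions with \<open>d > 0\<close>, the orders by \<open>x\<close> and by \<open>y\<close> agree, so the smallest
  positive solution is smallest in both components.\<close>

definition is_fundamental_solution :: "int \<Rightarrow> int \<times> int \<Rightarrow> bool" where
  "is_fundamental_solution d = (\<lambda>(x, y). x > 0 \<and> y > 0 \<and> is_pell_solution d (x, y) \<and>
     (\<forall>u v. u > 0 \<and> v > 0 \<and> is_pell_solution d (u, v) \<longrightarrow> x \<le> u \<and> y \<le> v))"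

text \<open>The pair is determined uniquely when \<open>d\<close> is positive and not a square, because
  \<open>sqrt d\<close> is then irrational.\<close>

definition pell_solution :: "int \<Rightarrow> nat \<Rightarrow> int \<times> int" where
  "pell_solution d n = (THE (x, y). \<exists>x1 y1. is_fundamental_solution d (x1, y1) \<and>
     real_of_int x + real_of_int y * sqrt (real_of_int d) =
       (real_of_int x1 + real_of_int y1 * sqrt (real_of_int d)) ^ n)"

end

theory Submission
  imports Defs
begin

text \<open>Writing \<open>s = sqrt d\<close> and \<open>c = a b - 1\<close>, the number \<open>c + s\<close> is a fixed point of the
  Moebius map of the block \<open>2 c, 1, a - 2, 1\<close>, so the complete quotients of \<open>s\<close> are periodic, and
  two steps of the continued fraction at least halve the distance to the limit. Fundamentality
  holds because for \<open>0 < v < a\<close> the number \<open>d v\<^sup>2 + 1\<close> lies strictly between the squares of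
  \<open>a b v - 1\<close> and \<open>a b v\<close>. Finally, prefixing one block acts on a quotient
  \<open>X / Y\<close> exactly as multiplication by \<open>(a\<^sup>2 b - 1) + a s\<close> acts on \<open>X + Y s\<close>.\<close>

section \<open>Convergence of continued fractions\<close>

lemma cfrac_value_ge_head:
  assumes "\<forall>q\<in>set qs. q \<ge> 1"
  shows "cfrac_value q0 qs \<ge> of_int q0"
  using assms
proof (induction qs arbitrary: q0)
  case (Cons q qs)
  then have "cfrac_value q qs \<ge> of_int q" "q \<ge> 1" by auto
  then have "cfrac_value q qs > 0" by linarith
  then show ?case by simp
qed simp

lemma cfrac_value_add_head:
  "cfrac_value (m + q) qs = of_int m + cfrac_value q qs"
  by (cases qs) auto

lemma cfrac_value_map_Suc:
  "cfrac_value (q k) (map q [Suc k..<Suc (k + Suc n)]) =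
     of_int (q k) + 1 / cfrac_value (q (Suc k)) (map q [Suc (Suc k)..<Suc (Suc k + n)])"
proof -
  have "[Suc k..<Suc (k + Suc n)] = Suc k # [Suc (Suc k)..<Suc (Suc k + n)]"
    by (subst upt_conv_Cons) auto
  then show ?thesis by simp
qed

text \<open>Dropping the head divides the error by the product of the next convergent tail and the
  next complete quotient. One such divisor is only known to be at least 1, but two consecutive ones
  multiply to at least 2, hence the exponent \<open>n div 2\<close>. The index \<open>k\<close>
  varies because the induction moves along the tails.\<close>

lemma cfrac_value_complete_quotient_error:
  fixes x :: "nat \<Rightarrow> real"
  assumes q: "\<And>i. i \<ge> 1 \<Longrightarrow> q i \<ge> 1"
    and x: "\<And>i. x i = of_int (q i) + 1 / x (Suc i)"
    and x1: "\<And>i. i \<ge> 1 \<Longrightarrow> x i \<ge> 1"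
  shows "\<bar>cfrac_value (q k) (map q [Suc k..<Suc (k + n)]) - x k\<bar> \<le> (1/2) ^ (n div 2)"
proof (induction n arbitrary: k rule: less_induct)
  case (less n)
  let ?C = "\<lambda>k n. cfrac_value (q k) (map q [Suc k..<Suc (k + n)])"
  have C1: "?C k n \<ge> 1" if "k \<ge> 1" for k n
  proof -
    have "?C k n \<ge> of_int (q k)"
      by (rule cfrac_value_ge_head) (use q that in auto)
    then show ?thesis using q[OF that] by linarith
  qed
  have step: "?C k (Suc m) - x k = (x (Suc k) - ?C (Suc k) m) / (?C (Suc k) m * x (Suc k))" for k m
  proof -
    have "?C (Suc k) m > 0" "x (Suc k) > 0"
      using C1[of "Suc k" m] x1[of "Suc k"] by linarith+
    moreover have "?C k (Suc m) - x k = 1 / ?C (Suc k) m - 1 / x (Suc k)"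
      using cfrac_value_map_Suc[of q k m] x[of k] by simp
    ultimately show ?thesis by (simp only: diff_frac_eq) simp
  qed
  have base: "\<bar>?C k 0 - x k\<bar> \<le> 1" for k
    using x[of k] x1[of "Suc k"] by simp
  consider "n = 0" | "n = 1" | m where "n = Suc (Suc m)"
    by (metis One_nat_def not0_implies_Suc)
  then show ?case
  proof cases
    case 1
    then show ?thesis using base[of k] by simp
  next
    case 2
    \<comment> \<open>Since \<open>1 div 2 = 0\<close>, it suffices that one step does not push the
      error above 1.\<close>
    let ?P = "?C (Suc k) 0 * x (Suc k)"
    have P: "?P \<ge> 1"
      using C1[of "Suc k" 0] x1[of "Suc k"] mult_mono[of 1 "?C (Suc k) 0" 1 "x (Suc k)"] by simp
    have "\<bar>?C k 1 - x k\<bar> = \<bar>?C (Suc k) 0 - x (Suc k)\<bar> / ?P"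
      using step[of k 0] P by (simp only: One_nat_def abs_divide abs_minus_commute)
    also have "\<dots> \<le> 1"
      using P base[of "Suc k"] by (subst divide_le_eq_1_pos) linarith+
    finally show ?thesis using 2 by simp
  next
    case 3
    let ?C1 = "?C (Suc k) (Suc m)" and ?C2 = "?C (Suc (Suc k)) m"
    let ?P = "(?C1 * x (Suc k)) * (?C2 * x (Suc (Suc k)))"
    have c: "?C1 \<ge> 1" "?C2 \<ge> 1" and xs: "x (Suc k) \<ge> 1" "x (Suc (Suc k)) \<ge> 1"
      using C1[of "Suc k" "Suc m"] C1[of "Suc (Suc k)" m] x1 by auto
    \<comment> \<open>The halving comes from the recursion: the product of two successive complete
      quotients is a partial quotient times a number \<open>\<ge> 1\<close>, plus 1.\<close>
    have "x (Suc k) * x (Suc (Suc k)) = of_int (q (Suc k)) * x (Suc (Suc k)) + 1"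
      using x[of "Suc k"] xs by (simp add: distrib_right)
    moreover have "of_int (q (Suc k)) * x (Suc (Suc k)) \<ge> 1 * 1"
      using q[of "Suc k"] xs by (intro mult_mono) auto
    ultimately have xx: "x (Suc k) * x (Suc (Suc k)) \<ge> 2" by linarith
    have cc: "?C1 * ?C2 \<ge> 1 * 1"
      using c by (intro mult_mono) auto
    have "1 * 2 \<le> (?C1 * ?C2) * (x (Suc k) * x (Suc (Suc k)))"
      by (rule mult_mono) (use cc xx in auto)
    then have P: "?P \<ge> 2" by (simp only: ac_simps)
    have p: "?C1 * x (Suc k) > 0" "?C2 * x (Suc (Suc k)) > 0"
      using c xs by (intro mult_pos_pos; linarith)+
    have e1: "\<bar>?C k (Suc (Suc m)) - x k\<bar> = \<bar>?C1 - x (Suc k)\<bar> / (?C1 * x (Suc k))"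
      unfolding step[of k "Suc m"] abs_divide abs_of_pos[OF p(1)] by (simp only: abs_minus_commute)
    have e2: "\<bar>?C1 - x (Suc k)\<bar> = \<bar>?C2 - x (Suc (Suc k))\<bar> / (?C2 * x (Suc (Suc k)))"
      unfolding step[of "Suc k" m] abs_divide abs_of_pos[OF p(2)] by (simp only: abs_minus_commute)
    have "\<bar>?C k (Suc (Suc m)) - x k\<bar> = \<bar>?C2 - x (Suc (Suc k))\<bar> / ?P"
      unfolding e1 e2 by (simp only: divide_divide_eq_left mult.commute)
    also have "\<dots> \<le> (1/2) ^ (m div 2) / 2"
      by (rule frac_le) (use less.IH[of m "Suc (Suc k)"] P 3 in auto)
    finally show ?thesis using 3 by simp
  qed
qed

text \<open>Reduces an expansion to algebra: it is enough to guess the complete quotients and check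
  their recursion.\<close>

theorem has_cfrac_expansion_complete_quotients:
  fixes x :: "nat \<Rightarrow> real"
  assumes q: "\<And>i. i \<ge> 1 \<Longrightarrow> q i \<ge> 1"
    and x: "\<And>i. x i = of_int (q i) + 1 / x (Suc i)"
    and x1: "\<And>i. i \<ge> 1 \<Longrightarrow> x i \<ge> 1"
  shows "has_cfrac_expansion (x 0) q"
  unfolding has_cfrac_expansion_def
proof
  have "filterlim (\<lambda>n::nat. n div 2) at_top sequentially"
    by (rule filterlim_at_top_div_const_nat) simp
  then have "(\<lambda>n. (1/2::real) ^ (n div 2)) \<longlonglongrightarrow> 0"
    by (rule filterlim_compose[rotated]) (rule LIMSEQ_power_zero, simp)
  then have "(\<lambda>n. cfrac_value (q 0) (map q [1..<Suc n]) - x 0) \<longlonglongrightarrow> 0"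
    by (rule tendsto_0_le[where K = 1])
      (use cfrac_value_complete_quotient_error[of q x 0, OF assms] in simp)
  then show "(\<lambda>n. cfrac_value (q 0) (map q [1..<Suc n])) \<longlonglongrightarrow> x 0"
    by (simp add: LIM_zero_iff)
qed (use q in auto)

section \<open>Solutions of the Pell equation\<close>

text \<open>Serves twice: for \<open>d\<close> itself, and for \<open>d v^2 + 1\<close> with
  \<open>0 < v < a\<close>, where it excludes smaller Pell solutions.\<close>

lemma not_square_between:
  fixes c d k :: int
  assumes "c \<ge> 0" "c^2 < d" "d < (c + 1)^2"
  shows "k^2 \<noteq> d"
proof
  assume "k^2 = d"
  then have "\<bar>k\<bar>^2 = d" by simp
  then have "c < \<bar>k\<bar>" "\<bar>k\<bar> < c + 1"
    using assms power_less_imp_less_base[of c 2 "\<bar>k\<bar>"]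
      power_less_imp_less_base[of "\<bar>k\<bar>" 2 "c + 1"] by auto
  then show False by linarith
qed

text \<open>Squaring moves the equation into the integers, where \<open>v - y\<close> must divide
  \<open>x - u\<close>; if \<open>v \<noteq> y\<close>, the quotient would be an integer square root
  of \<open>d\<close>.\<close>

lemma add_mult_sqrt_eq_iff:
  fixes d x y u v :: int
  assumes d: "d \<ge> 0" "\<And>k. k^2 \<noteq> d"
    and eq: "of_int x + of_int y * sqrt (of_int d) = of_int u + of_int v * sqrt (of_int d)"
  shows "x = u \<and> y = v"
proof -
  have "of_int (x - u) = of_int (v - y) * sqrt (of_int d)"
    using eq by (simp add: algebra_simps)
  then have "(of_int (x - u))^2 = (of_int (v - y))^2 * (of_int d :: real)"
    using d by (simp add: power_mult_distrib)
  then have sq: "(x - u)^2 = (v - y)^2 * d"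
    by (metis of_int_eq_iff of_int_mult of_int_power)
  then have "(v - y)^2 dvd (x - u)^2" by simp
  then have "v - y dvd x - u" by simp
  then obtain k where k: "x - u = (v - y) * k" by (elim dvdE)
  have "v = y"
  proof (rule ccontr)
    assume "v \<noteq> y"
    then have "k^2 = d" using sq k by (simp add: power_mult_distrib)
    with d show False by blast
  qed
  with k show ?thesis by simp
qed

lemma is_fundamental_solution_unique:
  assumes "is_fundamental_solution d (x, y)" "is_fundamental_solution d (u, v)"
  shows "u = x \<and> v = y"
  using assms unfolding is_fundamental_solution_def by (auto intro: order.antisym)

text \<open>Integer coefficients of the powers of \<open>x1 + y1 sqrt d\<close>, an explicit
  recursion to replace the definite description in \<open>pell_solution\<close>.\<close>

fun pell_power :: "int \<Rightarrow> int \<Rightarrow> int \<Rightarrow> nat \<Rightarrow> int \<times> int" where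
  "pell_power d x1 y1 0 = (1, 0)"
| "pell_power d x1 y1 (Suc n) =
     (case pell_power d x1 y1 n of (x, y) \<Rightarrow> (x1 * x + d * y1 * y, y1 * x + x1 * y))"

lemma pell_power_eq:
  assumes "d \<ge> 0" "pell_power d x1 y1 n = (x, y)"
  shows "of_int x + of_int y * sqrt (of_int d) =
    (of_int x1 + of_int y1 * sqrt (of_int d)) ^ n"
  using assms(2)
proof (induction n arbitrary: x y)
  case (Suc n)
  obtain u v where uv: "pell_power d x1 y1 n = (u, v)" by fastforce
  have s: "sqrt (of_int d) * sqrt (of_int d) = of_int d" using assms(1) by simp
  have "x = x1 * u + d * y1 * v" "y = y1 * u + x1 * v" using Suc.prems uv by auto
  moreover have "sqrt (of_int d) * (sqrt (of_int d) * z) = of_int d * z" for z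
    using s by (metis mult.assoc)
  ultimately show ?case
    using s by (simp add: Suc.IH[OF uv, symmetric] algebra_simps)
qed simp

text \<open>The description has exactly one witness: the fundamental solution in it is unique, and
  for non-square \<open>d\<close> the coefficients of its power can be compared.\<close>

lemma pell_solution_eq_pell_power:
  assumes d: "d \<ge> 0" "\<And>k. k^2 \<noteq> d"
    and fund: "is_fundamental_solution d (x1, y1)"
  shows "pell_solution d n = pell_power d x1 y1 n"
proof -
  obtain x y where xy: "pell_power d x1 y1 n = (x, y)" by fastforce
  note pow = pell_power_eq[OF d(1) xy]
  have "p = (x, y)"
    if "case p of (u, v) \<Rightarrow> \<exists>x1 y1. is_fundamental_solution d (x1, y1) \<and>
      real_of_int u + real_of_int v * sqrt (real_of_int d) =
        (real_of_int x1 + real_of_int y1 * sqrt (real_of_int d)) ^ n" for p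
  proof -
    obtain u v where p: "p = (u, v)" by fastforce
    then have "of_int u + of_int v * sqrt (of_int d) =
        (of_int x1 + of_int y1 * sqrt (of_int d)) ^ n"
      using that is_fundamental_solution_unique[OF fund] by auto
    then have "of_int u + of_int v * sqrt (of_int d) = of_int x + of_int y * sqrt (of_int d)"
      using pow by simp
    then show ?thesis using add_mult_sqrt_eq_iff[OF d] p by blast
  qed
  then show ?thesis
    unfolding pell_solution_def xy using fund pow by (intro the_equality) auto
qed

lemma pell_power_pos:
  assumes "d > 0" "x1 > 0" "y1 > 0" "pell_power d x1 y1 n = (x, y)"
  shows "x > 0 \<and> y \<ge> 0 \<and> (n > 0 \<longrightarrow> y > 0)"
  using assms(4)
proof (induction n arbitrary: x y)
  case (Suc n)
  obtain u v where uv: "pell_power d x1 y1 n = (u, v)" by fastforce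
  with Suc.IH have "u > 0" "v \<ge> 0" by auto
  then show ?case
    using Suc.prems uv assms(1-3) by (auto intro!: add_pos_nonneg)
qed simp

section \<open>The family \<open>d = a\<^sup>2 b\<^sup>2 - 2 b\<close>\<close>

text \<open>The two gaps are \<open>2 b v (a - v)\<close> and \<open>2 b v^2 - 1\<close>. The first
  vanishes at \<open>v = a\<close>, which is where the solution \<open>(a^2 b - 1, a)\<close>
  appears.\<close>

lemma pell_family_between:
  fixes a b v :: int
  assumes "b \<ge> 1" "0 < v" "v < a"
  shows "(a * b * v - 1)^2 < (a^2 * b^2 - 2 * b) * v^2 + 1"
    and "(a^2 * b^2 - 2 * b) * v^2 + 1 < (a * b * v)^2"
proof -
  have "b * v * v < b * v * a" using assms by (intro mult_strict_left_mono) auto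
  then show "(a * b * v - 1)^2 < (a^2 * b^2 - 2 * b) * v^2 + 1"
    by (simp add: power2_eq_square algebra_simps)
  have "b * v^2 \<ge> 1 * 1" using assms by (intro mult_mono) auto
  then show "(a^2 * b^2 - 2 * b) * v^2 + 1 < (a * b * v)^2"
    by (simp add: power2_eq_square algebra_simps)
qed

text \<open>The lower gap is \<open>d - (a b - 1)^2 = 2 b (a - 1) - 1\<close>. Lying between
  consecutive squares, \<open>d\<close> is not a square.\<close>

lemma pell_family_bounds:
  fixes a b d :: int
  assumes "a \<ge> 3" "b \<ge> 1" and d: "d = a^2 * b^2 - 2 * b"
  shows "a * b \<ge> 3" "(a * b - 1)^2 < d" "d < (a * b)^2" "d > 0"
proof -
  have "a * b \<ge> 3 * 1" using assms by (intro mult_mono) auto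
  then show ab: "a * b \<ge> 3" by simp
  have "a * b \<ge> 3 * b" using assms by (intro mult_right_mono) auto
  then have "a * b * 2 > b * 2 + 1" using assms(2) by linarith
  then show lower: "(a * b - 1)^2 < d"
    by (simp add: d power2_eq_square algebra_simps)
  show "d < (a * b)^2" using assms by (simp add: power_mult_distrib)
  show "d > 0" using lower zero_le_power2[of "a * b - 1"] by linarith
qed

text \<open>Minimality is settled in the second component first; the first follows because
  \<open>d v^2 + 1\<close> grows with \<open>v\<close>.\<close>

lemma pell_family_fundamental:
  fixes a b d :: int
  assumes "a \<ge> 3" "b \<ge> 1" and d: "d = a^2 * b^2 - 2 * b"
  shows "is_fundamental_solution d (a^2 * b - 1, a)"
proof -
  have sol: "(a^2 * b - 1)^2 - d * a^2 = 1"
    unfolding d by (simp add: power2_eq_square algebra_simps)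
  have "a^2 * b \<ge> 3^2 * 1" using assms by (intro mult_mono power_mono) auto
  then have xpos: "a^2 * b - 1 > 0" by simp
  have "a^2 * b - 1 \<le> u \<and> a \<le> v"
    if "u > 0" "v > 0" and uv: "u^2 - d * v^2 = 1" for u v
  proof -
    have av: "a \<le> v"
    proof (rule ccontr)
      assume "\<not> a \<le> v"
      with assms that have v: "b \<ge> 1" "0 < v" "v < a" by auto
      have "a * b * v > 0" using v by simp
      moreover have "u^2 = (a^2 * b^2 - 2 * b) * v^2 + 1" using uv d by simp
      ultimately show False
        using not_square_between[of "a * b * v - 1" "u^2" u] pell_family_between[OF v] by simp
    qed
    then have "d * a^2 \<le> d * v^2"
      using assms pell_family_bounds(4)[OF assms] by (intro mult_left_mono power_mono) auto
    then have "(a^2 * b - 1)^2 \<le> u^2" using sol uv by linarith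
    with av show ?thesis using \<open>u > 0\<close> power2_le_imp_le[of "a^2 * b - 1" u] by auto
  qed
  with sol xpos assms show ?thesis
    unfolding is_fundamental_solution_def is_pell_solution_def by auto
qed

text \<open>The tail \<open>t\<close> enters through \<open>w = t + 1\<close>, which makes the block act as \<open>w / (a w - 1)\<close>.\<close>

lemma block_value:
  fixes a b t :: real
  assumes "a \<ge> 3" "t > 0"
  shows "(a * b - 1) + 1 / (1 + 1 / ((a - 2) + 1 / (1 + 1 / t))) =
    a * b - (t + 1) / (a * (t + 1) - 1)"
proof -
  have "(a - 1) * (t + 1) > 2 * 1" using assms by (intro mult_le_less_imp_less) auto
  then have p: "(a - 1) * (t + 1) - 1 > 0" "a * (t + 1) - 1 > 0"
    using assms by (auto simp: algebra_simps)
  have "1 / (1 + 1 / t) = t / (t + 1)"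
    using assms by (simp add: field_simps)
  then have eq: "(a - 2) + 1 / (1 + 1 / t) = ((a - 1) * (t + 1) - 1) / (t + 1)"
    using assms by (simp add: field_simps)
  have "1 + 1 / ((a - 2) + 1 / (1 + 1 / t)) = (a * (t + 1) - 1) / ((a - 1) * (t + 1) - 1)"
    unfolding eq using p(1) by (simp add: divide_simps) (simp add: algebra_simps)
  then have "1 / (1 + 1 / ((a - 2) + 1 / (1 + 1 / t))) =
      ((a - 1) * (t + 1) - 1) / (a * (t + 1) - 1)"
    by simp
  also have "\<dots> = 1 - (t + 1) / (a * (t + 1) - 1)"
    using p(2) by (simp add: divide_simps) (simp add: algebra_simps)
  finally show ?thesis by simp
qed

lemma pell_family_expansion:
  fixes a b d :: int
  assumes a: "a \<ge> 3" and b: "b \<ge> 1" and d: "d = a^2 * b^2 - 2 * b"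
  shows "has_cfrac_expansion (sqrt (real_of_int d))
    (periodic_quotients (a * b - 1) [1, a - 2, 1, 2 * a * b - 2])"
proof -
  define s where "s = sqrt (real_of_int d)"
  define A where "A = real_of_int a"
  define B where "B = real_of_int b"
  \<comment> \<open>The guess for the complete quotient with integer part \<open>2 a b - 2\<close>.
    The other three are computed backwards from it, so only the equation that closes the cycle,
    \<open>fix_s\<close>, is left to prove.\<close>
  define x4 where "x4 = A * B - 1 + s"
  define x3 where "x3 = 1 + 1 / x4"
  define x2 where "x2 = A - 2 + 1 / x3"
  define x1 where "x1 = 1 + 1 / x2"
  define x where "x i = (if i = 0 then s else [x1, x2, x3, x4] ! ((i - 1) mod 4))" for i :: nat
  let ?q = "periodic_quotients (a * b - 1) [1, a - 2, 1, 2 * a * b - 2]"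
  note bounds = pell_family_bounds[OF assms]
  have "s * s = real_of_int d" using bounds(4) by (simp add: s_def)
  then have "s * s = A^2 * B^2 - 2 * B" by (simp add: d A_def B_def)
  moreover have "s > 0" using bounds(4) by (simp add: s_def)
  ultimately have s: "s > 0" "s * s = A^2 * B^2 - 2 * B" by auto
  have A: "A \<ge> 3" using a by (simp add: A_def)
  have "real_of_int (a * b) \<ge> 3" using bounds(1) by linarith
  then have AB: "A * B \<ge> 3" by (simp add: A_def B_def)
  have x4: "x4 \<ge> 1" using AB s by (simp add: x4_def)
  have x3: "x3 \<ge> 1" using x4 by (simp add: x3_def)
  have x2: "x2 \<ge> 1" using x3 A by (simp add: x2_def add_increasing2)
  have x1: "x1 \<ge> 1" using x2 by (simp add: x1_def)
  have "A * (x4 + 1) - 1 > 0"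
    using mult_mono[of 3 A 2 "x4 + 1"] A x4 by simp
  \<comment> \<open>This is the fixed-point equation of \<open>block_value\<close> at
    \<open>t = x4\<close>, cleared of its denominator; the shape of \<open>d\<close> enters through
    \<open>s * s\<close>.\<close>
  moreover have "(A * B - s) * (A * (x4 + 1) - 1) = x4 + 1"
  proof -
    have "(A * B - s) * (A * (x4 + 1) - 1) = A * (A^2 * B^2 - s * s) - A * B + s"
      by (simp add: x4_def algebra_simps power2_eq_square)
    also have "\<dots> = x4 + 1"
      unfolding s(2) x4_def by simp
    finally show ?thesis .
  qed
  ultimately have "(x4 + 1) / (A * (x4 + 1) - 1) = A * B - s"
    by (subst nonzero_divide_eq_eq) auto
  then have fix_s: "s = (A * B - 1) + 1 / x1"
    using block_value[of A x4 B] A x4 by (simp add: x1_def x2_def x3_def)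
  have q: "?q i \<ge> 1" if "i \<ge> 1" for i
  proof -
    have "(i - 1) mod 4 \<in> {0, 1, 2, 3}" by auto
    then show ?thesis
      using that a bounds(1) by (auto simp: periodic_quotients_def)
  qed
  have rec: "x i = of_int (?q i) + 1 / x (Suc i)" for i
  proof (cases i)
    case 0
    then show ?thesis
      using fix_s by (simp add: x_def periodic_quotients_def A_def B_def)
  next
    case (Suc j)
    have "j mod 4 \<in> {0, 1, 2, 3}" by auto
    then consider "j mod 4 = 0" "Suc j mod 4 = 1" | "j mod 4 = 1" "Suc j mod 4 = 2"
      | "j mod 4 = 2" "Suc j mod 4 = 3" | "j mod 4 = 3" "Suc j mod 4 = 0"
      by (auto simp: mod_Suc)
    then show ?thesis
    proof cases
      case 1
      then show ?thesis by (simp add: x_def periodic_quotients_def Suc x1_def)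
    next
      case 2
      then show ?thesis by (simp add: x_def periodic_quotients_def Suc x2_def A_def)
    next
      case 3
      then show ?thesis by (simp add: x_def periodic_quotients_def Suc x3_def)
    next
      case 4
      \<comment> \<open>Wrapping around: adding \<open>A B - 1\<close> to \<open>fix_s\<close> turns
        the initial entry into the last entry of the period.\<close>
      have "x4 = 2 * A * B - 2 + 1 / x1" using fix_s by (simp add: x4_def)
      with 4 show ?thesis by (simp add: x_def periodic_quotients_def Suc A_def B_def)
    qed
  qed
  have "x i \<ge> 1" if "i \<ge> 1" for i
  proof -
    have "(i - 1) mod 4 \<in> {0, 1, 2, 3}" by auto
    then show ?thesis
      using that x1 x2 x3 x4 by (auto simp: x_def)
  qed
  from has_cfrac_expansion_complete_quotients[of ?q x, OF q rec this]
  show ?thesis by (simp add: x_def s_def)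
qed

text \<open>Each list stops just before an entry \<open>2 a b - 2\<close>. The induction starts from
  \<open>[a b - 1; 1, a - 2, 1] = a b - 1/a\<close>, the quotient of the fundamental solution;
  ending in a single \<open>1\<close> would give \<open>a b\<close> there.\<close>

lemma pell_family_convergent:
  fixes a b d :: int
  assumes a: "a \<ge> 3" and b: "b \<ge> 1" and d: "d = a^2 * b^2 - 2 * b"
    and xy: "pell_power d (a^2 * b - 1) a (Suc n) = (x, y)"
  shows "real_of_int x / real_of_int y =
    cfrac_value (a * b - 1)
      (concat (replicate n [1, a - 2, 1, 2 * a * b - 2]) @ [1, a - 2, 1])"
  using xy
proof (induction n arbitrary: x y)
  case 0
  then have "real_of_int x = of_int a ^ 2 * of_int b - 1" "y = a" by auto
  moreover have "1 + 1 / (real_of_int a - 1) = of_int a / (of_int a - 1)"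
    using a by (simp add: field_simps)
  ultimately show ?case
    using a by (simp add: field_simps power2_eq_square)
next
  case (Suc n)
  let ?qs = "concat (replicate n [1, a - 2, 1, 2 * a * b - 2]) @ [1, a - 2, 1]"
  define A where "A = real_of_int a"
  define B where "B = real_of_int b"
  define V where "V = cfrac_value (a * b - 1) ?qs"
  \<comment> \<open>Since \<open>2 a b - 2\<close> is twice \<open>a b - 1\<close>, the tail
    starting with it is the previous convergent \<open>V\<close> shifted by
    \<open>a b - 1\<close>.\<close>
  define t where "t = A * B - 1 + V"
  note bounds = pell_family_bounds[OF a b d]
  obtain u v where uv: "pell_power d (a^2 * b - 1) a (Suc n) = (u, v)" by fastforce
  have "a^2 * b \<ge> 3^2 * 1" using a b by (intro mult_mono power_mono) auto
  then have uv_pos: "u > 0" "v > 0"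
    using pell_power_pos[OF bounds(4) _ _ uv] a by auto
  have V: "V = of_int u / of_int v"
    unfolding V_def using Suc.IH[OF uv] by simp
  have A: "A \<ge> 3" using a by (simp add: A_def)
  have "real_of_int (a * b) \<ge> 3" using bounds(1) by linarith
  then have AB: "A * B \<ge> 3" by (simp add: A_def B_def)
  have t: "t > 0" using AB uv_pos by (simp add: t_def V add_pos_pos)
  have "2 * a * b - 2 = (a * b - 1) + (a * b - 1)" by simp
  then have "cfrac_value (2 * a * b - 2) ?qs = cfrac_value ((a * b - 1) + (a * b - 1)) ?qs"
    by (rule arg_cong)
  also have "\<dots> = t"
    unfolding cfrac_value_add_head t_def V_def A_def B_def by simp
  finally have tail: "cfrac_value (2 * a * b - 2) ?qs = t" .
  have w: "A * (t + 1) - 1 > 0"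
    using mult_mono[of 3 A 1 "t + 1"] A t by simp
  have "cfrac_value (a * b - 1)
      (concat (replicate (Suc n) [1, a - 2, 1, 2 * a * b - 2]) @ [1, a - 2, 1]) =
      (A * B - 1) + 1 / (1 + 1 / ((A - 2) + 1 / (1 + 1 / t)))"
    using tail by (simp add: A_def B_def)
  also have "\<dots> = A * B - (t + 1) / (A * (t + 1) - 1)"
    by (rule block_value[OF A t])
  \<comment> \<open>The coefficients form the matrix of multiplication by
    \<open>(a^2 b - 1) + a sqrt d\<close>, so on \<open>V = u / v\<close> the block performs one
    step of \<open>pell_power\<close>.\<close>
  also have "\<dots> = ((A^2 * B - 1) * V + of_int d * A) / (A * V + (A^2 * B - 1))"
  proof -
    have "A * (t + 1) - 1 = A * V + (A^2 * B - 1)"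
      by (simp add: t_def algebra_simps power2_eq_square)
    moreover have "A * B * (A * (t + 1) - 1) - (t + 1) = (A^2 * B - 1) * V + of_int d * A"
      by (simp add: t_def d A_def B_def algebra_simps power2_eq_square)
    ultimately show ?thesis
      using w by (simp add: diff_divide_eq_iff)
  qed
  also have "\<dots> = ((A^2 * B - 1) * of_int u + of_int d * A * of_int v) /
      (A * of_int u + (A^2 * B - 1) * of_int v)"
  proof -
    have "(A^2 * B - 1) * of_int u + of_int d * A * of_int v =
        ((A^2 * B - 1) * V + of_int d * A) * of_int v"
      "A * of_int u + (A^2 * B - 1) * of_int v = (A * V + (A^2 * B - 1)) * of_int v"
      using uv_pos by (simp_all add: V field_simps)
    then show ?thesis using uv_pos by simp
  qed
  also have "\<dots> = of_int x / of_int y"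
  proof -
    have "x = (a^2 * b - 1) * u + d * a * v" "y = a * u + (a^2 * b - 1) * v"
      using Suc.prems uv by auto
    then show ?thesis by (simp add: A_def B_def)
  qed
  finally show ?case by simp
qed

theorem theorem9:
  fixes a b d :: int
  assumes "a \<ge> 3" and "b \<ge> 1"
    and d: "d = a^2 * b^2 - 2 * b"
  shows "has_cfrac_expansion (sqrt (real_of_int d))
           (periodic_quotients (a * b - 1) [1, a - 2, 1, 2 * a * b - 2])
       \<and> is_fundamental_solution d (a^2 * b - 1, a)
       \<and> (\<forall>n\<ge>1. real_of_int (fst (pell_solution d n)) / real_of_int (snd (pell_solution d n)) =
             cfrac_value (a * b - 1)
               (concat (replicate (n - 1) [1, a - 2, 1, 2 * a * b - 2]) @ [1, a - 2, 1]))"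
proof (intro conjI allI impI)
  note bounds = pell_family_bounds[OF assms]
  note fund = pell_family_fundamental[OF assms]
  show "has_cfrac_expansion (sqrt (real_of_int d))
    (periodic_quotients (a * b - 1) [1, a - 2, 1, 2 * a * b - 2])"
    by (rule pell_family_expansion[OF assms])
  show "is_fundamental_solution d (a^2 * b - 1, a)" by (rule fund)
  fix n :: nat
  assume "n \<ge> 1"
  then have n: "n = Suc (n - 1)" by simp
  have "k^2 \<noteq> d" for k
    using not_square_between[of "a * b - 1" d k] bounds by simp
  then have "pell_solution d n = pell_power d (a^2 * b - 1) a n"
    using pell_solution_eq_pell_power[OF _ _ fund] bounds(4) by simp
  then have "pell_power d (a^2 * b - 1) a (Suc (n - 1)) =
      (fst (pell_solution d n), snd (pell_solution d n))"
    using n by simp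
  then show "real_of_int (fst (pell_solution d n)) / real_of_int (snd (pell_solution d n)) =
      cfrac_value (a * b - 1)
        (concat (replicate (n - 1) [1, a - 2, 1, 2 * a * b - 2]) @ [1, a - 2, 1])"
    by (rule pell_family_convergent[OF assms])
qed

end
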